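(* Let $n$ be an integer greater than $1$. The map $\Phi\colon\mathcal{C}_n^0/\mathrm{SL}_2(\mathbb{Z})\longrightarrow \mathbf{FR}_n^0$, which sends the $\mathrm{SL}_2(\mathbb{Z})$-orbit of a closed path in $\mathcal{C}_n^0$ (extended to an $n$-periodic bi-infinite path with suitably normalised vertices $a_i/b_i$) to $\pm\mathbf{M}$, where $m_{i,j}=a_jb_i-b_ja_i$, is a one-to-one correspondence (a bijection).
   Context: An $\mathrm{SL}_2$-tiling is a function $\mathbf{M}\colon\mathbb{Z}\times\mathbb{Z}\to\mathbb{Z}$, with $m_{i,j}=\mathbf{M}(i,j)$, such that $m_{i,j}m_{i+1,j+1}-m_{i,j+1}m_{i+1,j}=1$ for all $i,j\in\mathbb{Z}$. It is tame if every $3\times 3$ submatrix of consecutive rows and columns has determinant $0$. A tame frieze of order $n$ is a tame $\mathrm{SL}_2$-tiling $\mathbf{M}$ such that $m_{i,i}=m_{i+n,i}=0$ for all $i\in\mathbb{Z}$; such a tiling satisfies $m_{j,i}=-m_{i,j}$ for all $i,j$, and the entries $m_{i+1,i}$ are either all $1$ or all $-1$. If they are all $1$, the quiddity sequence of $\mathbf{M}$ is $(m_{i+1,i-1})_{i\in\mathbb{Z}}$; if they are all $-1$, the quiddity sequence of $\mathbf{M}$ is defined to be that of $-\mathbf{M}$. $\mathbf{FR}_n$ is the set of tame friezes of order $n$ with $\mathbf{M}$ and $-\mathbf{M}$ identified (elements written $\pm\mathbf{M}$), and $\mathbf{FR}_n^0\subset\mathbf{FR}_n$ is the subset of those $\pm\mathbf{M}$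 whose quiddity sequence consists of positive integers. A reduced rational is an expression $a/b$ with $a,b$ coprime integers, where $1/0$ and $(-1)/0$ are allowed and both represent $\infty$. The Farey graph $\mathcal{F}$ has vertex set $\mathbb{Q}_\infty=\mathbb{Q}\cup\{\infty\}$, with reduced rationals $a/b$ and $c/d$ adjacent if and only if $ad-bc=\pm1$. A closed path of length $n$ in $\mathcal{F}$ is a sequence $\langle v_0,v_1,\dots,v_n\rangle$ of vertices with $v_i$ adjacent to $v_{i+1}$ for $0\leq i<n$ and $v_0=v_n$. Identify $\mathbb{R}_\infty=\mathbb{R}\cup\{\infty\}$ with the unit circle by $z\mapsto(iz+1)/(z+i)$ (so $\infty\mapsto i$, $1\mapsto1$, $0\mapsto-i$, $-1\mapsto-1$); three points of $\mathbb{R}_\infty$ are in clockwise order if they are distinct and their images are in clockwise order around the unit circle. $\mathcal{C}_n^0$ is the set of closed paths $\langle v_0,v_1,\dots,v_n\rangle$ of length $n$ for which $v_{i-1},v_i,v_{i+1}$ is in clockwise order for $i=1,2,\dots,n$, where $v_{n+1}=v_1$. A closed path of length $n$ is identified with the bi-infinite path $\langle\dots,v_{-1},v_0,v_1,v_2,\dots\rangle$ with $v_i=v_j$ whenever $i\equiv j\pmod n$. $\mathrm{SL}_2(\mathbb{Z})$ acts on $\mathbb{Q}_\infty$ by Möbius transformations $z\mapsto\frac{az+b}{cz+d}$, preserving adjacency and clockwise order, hence acts vertexwise on $\mathcal{C}_n^0$. Given a bi-infinite path $\gamma$, write its vertices as reduced rationals $v_i=a_i/b_i$ with $a_ib_{i+1}-a_{i+1}b_i=1$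 for all $i\in\mathbb{Z}$ (possible in exactly two ways, differing by a global sign), and put $m_{i,j}=a_jb_i-b_ja_i$. The resulting $\pm\mathbf{M}$ depends only on the $\mathrm{SL}_2(\mathbb{Z})$-orbit of $\gamma$; this is $\Phi$ of that orbit. *)

theory Defs
  imports "HOL-Analysis.Analysis"
begin

definition SL2_tiling :: "(int \<Rightarrow> int \<Rightarrow> int) \<Rightarrow> bool" where
  "SL2_tiling M \<longleftrightarrow> (\<forall>i j. M i j * M (i+1) (j+1) - M i (j+1) * M (i+1) j = 1)"

definition tame :: "(int \<Rightarrow> int \<Rightarrow> int) \<Rightarrow> bool" where
  "tame M \<longleftrightarrow> (\<forall>i j.
     det (vector [vector [M i j,     M i (j+1),     M i (j+2)],
                  vector [M (i+1) j, M (i+1) (j+1), M (i+1) (j+2)],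
                  vector [M (i+2) j, M (i+2) (j+1), M (i+2) (j+2)]] :: int^3^3) = 0)"

definition tame_frieze :: "nat \<Rightarrow> (int \<Rightarrow> int \<Rightarrow> int) \<Rightarrow> bool" where
  "tame_frieze n M \<longleftrightarrow> SL2_tiling M \<and> tame M \<and> (\<forall>i. M i i = 0 \<and> M (i + int n) i = 0)"

text \<open>For a tame frieze the entries \<open>M (i+1) i\<close> are all \<open>1\<close> or all \<open>-1\<close>; the second branch
  below is the latter case, where the quiddity sequence is that of the negated tiling.\<close>

definition quiddity :: "(int \<Rightarrow> int \<Rightarrow> int) \<Rightarrow> int \<Rightarrow> int" where
  "quiddity M i =
     (if \<forall>k. M (k+1) k = 1 then M (i+1) (i-1) else - M (i+1) (i-1))"

definition plus_minus :: "(int \<Rightarrow> int \<Rightarrow> int) \<Rightarrow> (int \<Rightarrow> int \<Rightarrow> int) set" where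
  "plus_minus M = {M, \<lambda>i j. - M i j}"

definition FR :: "nat \<Rightarrow> (int \<Rightarrow> int \<Rightarrow> int) set set" where
  "FR n = plus_minus ` {M. tame_frieze n M}"

definition FR0 :: "nat \<Rightarrow> (int \<Rightarrow> int \<Rightarrow> int) set set" where
  "FR0 n = {S \<in> FR n. \<forall>M\<in>S. \<forall>i. quiddity M i > 0}"

text \<open>In \<open>rat option\<close> and \<open>real option\<close>, \<open>None\<close> is the point at infinity. The vertex
  represented by \<open>a/b\<close> is meaningful for coprime \<open>a\<close>, \<open>b\<close>, so that \<open>b = 0\<close> occurs only with
  \<open>a = 1\<close> or \<open>a = -1\<close>.\<close>

definition farey_vertex :: "int \<Rightarrow> int \<Rightarrow> rat option" where
  "farey_vertex a b = (if b = 0 then None else Some (of_int a / of_int b))"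

definition farey_adj :: "rat option \<Rightarrow> rat option \<Rightarrow> bool" where
  "farey_adj x y \<longleftrightarrow> (\<exists>a b c d. coprime a b \<and> coprime c d \<and>
     x = farey_vertex a b \<and> y = farey_vertex c d \<and> \<bar>a * d - b * c\<bar> = 1)"

definition to_circle :: "real option \<Rightarrow> complex" where
  "to_circle z = (case z of None \<Rightarrow> \<i>
     | Some t \<Rightarrow> (\<i> * complex_of_real t + 1) / (complex_of_real t + \<i>))"

definition circle_clockwise :: "complex \<Rightarrow> complex \<Rightarrow> complex \<Rightarrow> bool" where
  "circle_clockwise x y z \<longleftrightarrow> (\<exists>\<alpha> \<beta> \<gamma>. x = cis \<alpha> \<and> y = cis \<beta> \<and> z = cis \<gamma> \<and>
     \<alpha> > \<beta> \<and> \<beta> > \<gamma> \<and> \<gamma> > \<alpha> - 2 * pi)"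

definition clockwise :: "real option \<Rightarrow> real option \<Rightarrow> real option \<Rightarrow> bool" where
  "clockwise x y z \<longleftrightarrow> distinct [x, y, z] \<and>
     circle_clockwise (to_circle x) (to_circle y) (to_circle z)"

abbreviation real_point :: "rat option \<Rightarrow> real option" where
  "real_point \<equiv> map_option real_of_rat"

text \<open>A path of length \<open>n\<close> is the list of its \<open>n + 1\<close> vertices.\<close>

definition closed_path :: "nat \<Rightarrow> rat option list \<Rightarrow> bool" where
  "closed_path n v \<longleftrightarrow> length v = n + 1 \<and> (\<forall>i<n. farey_adj (v ! i) (v ! (i+1))) \<and> v ! 0 = v ! n"

definition C0 :: "nat \<Rightarrow> rat option list set" where
  "C0 n = {v. closed_path n v \<and>
     (\<forall>i\<in>{1..n}. clockwise (real_point (v ! (i-1))) (real_point (v ! i))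
        (real_point (if i = n then v ! 1 else v ! (i+1))))}"

definition bi_infinite :: "nat \<Rightarrow> rat option list \<Rightarrow> int \<Rightarrow> rat option" where
  "bi_infinite n v i = v ! nat (i mod int n)"

definition SL2Z :: "(int^2^2) set" where
  "SL2Z = {A. det A = 1}"

definition mobius :: "int^2^2 \<Rightarrow> rat option \<Rightarrow> rat option" where
  "mobius A z =
     (let a = of_int (A $ 1 $ 1); b = of_int (A $ 1 $ 2);
          c = of_int (A $ 2 $ 1); d = of_int (A $ 2 $ 2)
      in case z of
           None \<Rightarrow> if c = 0 then None else Some (a / c)
         | Some q \<Rightarrow> if c * q + d = 0 then None else Some ((a * q + b) / (c * q + d)))"

definition orbit :: "rat option list \<Rightarrow> rat option list set" where
  "orbit v = (\<lambda>A. map (mobius A) v) ` SL2Z"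

definition C0_orbits :: "nat \<Rightarrow> rat option list set set" where
  "C0_orbits n = orbit ` C0 n"

definition normalised_lift :: "(int \<Rightarrow> rat option) \<Rightarrow> (int \<Rightarrow> int) \<Rightarrow> (int \<Rightarrow> int) \<Rightarrow> bool" where
  "normalised_lift v a b \<longleftrightarrow>
     (\<forall>i. coprime (a i) (b i) \<and> v i = farey_vertex (a i) (b i)) \<and>
     (\<forall>i. a i * b (i+1) - a (i+1) * b i = 1)"

text \<open>\<open>Phi\<close> is the union of the classes obtained from all paths in the orbit and all normalised
  lifts. That there is exactly one such class is not built in: with none or several, the union
  would be no element of \<open>FR n\<close>.\<close>

definition Phi :: "nat \<Rightarrow> rat option list set \<Rightarrow> (int \<Rightarrow> int \<Rightarrow> int) set" where
  "Phi n X = \<Union> {plus_minus (\<lambda>i j. a j * b i - b j * a i) | v a b.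
     v \<in> X \<and> normalised_lift (bi_infinite n v) a b}"

end

theory Submission imports Defs begin

text \<open>Write a normalised path as a sequence of integer vectors \<open>u\<^sub>i = (a\<^sub>i, b\<^sub>i)\<close> with
  \<open>det (u\<^sub>i, u\<^sub>i\<^sub>+\<^sub>1) = 1\<close>, so that \<open>m\<^sub>i\<^sub>j = det (u\<^sub>j, u\<^sub>i)\<close>. Since
  \<open>u\<^sub>j = m\<^sub>1\<^sub>j u\<^sub>0 - m\<^sub>0\<^sub>j u\<^sub>1\<close>, the tiling determines the path up to the matrix that moves
  the basis \<open>(u\<^sub>0, u\<^sub>1)\<close>. Conversely, tameness makes consecutive rows and columns of a tiling satisfy a
  three-term linear recurrence; with zero diagonal and \<open>m\<^sub>i\<^sub>+\<^sub>1\<^sub>,\<^sub>i = 1\<close> the rows and columns share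
  their coefficients \<open>m\<^sub>i\<^sub>+\<^sub>2\<^sub>,\<^sub>i\<close>, hence \<open>m\<^sub>i\<^sub>j = m\<^sub>0\<^sub>j m\<^sub>1\<^sub>i - m\<^sub>1\<^sub>j m\<^sub>0\<^sub>i\<close> and the
  vectors \<open>(m\<^sub>1\<^sub>j, -m\<^sub>0\<^sub>j)\<close> form a path; \<open>m\<^sub>i\<^sub>+\<^sub>n\<^sub>,\<^sub>i = 0\<close> says that it closes up. Finally,
  the point \<open>a/b\<close> corresponds to \<open>i cnj(w) / w\<close> on the unit circle, where \<open>w = a + ib\<close>, so its
  angle is \<open>\<pi>/2 - 2 arg w\<close>, and \<open>v\<^sub>i\<^sub>-\<^sub>1, v\<^sub>i, v\<^sub>i\<^sub>+\<^sub>1\<close> is in clockwise order exactly when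
  \<open>det (u\<^sub>i\<^sub>-\<^sub>1, u\<^sub>i\<^sub>+\<^sub>1)\<close>, the quiddity at \<open>i\<close>, is positive.\<close>

subsection \<open>Farey vertices and their Moebius images\<close>

lemma int_shift_invariant_const:
  fixes f :: "int \<Rightarrow> 'a"
  assumes "\<And>i. f (i + 1) = f i"
  shows "f i = f 0"
proof (induction i rule: int_induct[where k = 0])
  case (step2 i)
  then show ?case using assms[of "i - 1"] by simp
qed (use assms in simp_all)

text \<open>Take \<open>e i\<close> to be the product of the signs between 0 and \<open>i\<close>.
  One of the two intervals is always empty; for negative \<open>i\<close> the recursion holds
  because each sign is its own inverse.\<close>

lemma int_recursion_sign:
  fixes s :: "int \<Rightarrow> int"
  assumes "\<And>i. \<bar>s i\<bar> = 1"
  obtains e where "\<And>i. \<bar>e i\<bar> = 1" "\<And>i. e (i + 1) = s i * e i"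
proof
  define e where "e i = prod s {0..<i} * prod s {i..<0}" for i
  show "\<bar>e i\<bar> = 1" for i
    by (simp add: e_def abs_mult abs_prod assms)
  have sq: "s i * s i = 1" for i
    using assms[of i] by (metis abs_mult_self_eq mult_1)
  show "e (i + 1) = s i * e i" for i
  proof (cases "i \<ge> 0")
    case True
    then have "{0..<i+1} = insert i {0..<i}" by auto
    with True show ?thesis by (simp add: e_def)
  next
    case False
    then have "{i..<0} = insert i {i+1..<0}" by auto
    with False have "prod s {i..<0} = s i * prod s {i+1..<0}" by simp
    with False sq[of i] show ?thesis
      by (simp add: e_def flip: mult.assoc)
  qed
qed

text \<open>Bezout coefficients of \<open>a\<close> and \<open>b\<close> yield the multiplier
  \<open>s\<close>. It divides both \<open>c\<close> and \<open>d\<close>, hence is a unit.\<close>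

lemma proportional_coprime_eq_sign:
  fixes a b c d :: int
  assumes "coprime a b" "coprime c d" "a * d = b * c"
  obtains s where "\<bar>s\<bar> = 1" "c = s * a" "d = s * b"
proof -
  obtain x y where xy: "x * a + y * b = 1"
    using assms(1) bezout_int[of a b] by (auto simp: coprime_iff_gcd_eq_1)
  define s where "s = x * c + y * d"
  have c: "c = s * a" and d: "d = s * b"
    using xy assms(3) unfolding s_def by algebra+
  have "is_unit s"
    using assms(2) c d by (meson coprime_common_divisor dvd_triv_left)
  then show thesis
    using that c d by (simp add: zdvd1_eq)
qed

lemma coprime_if_det_eq_1:
  fixes a b c d :: int
  assumes "a * d - c * b = 1"
  shows "coprime a b"
proof (rule coprimeI)
  fix k assume "k dvd a" "k dvd b"
  then have "k dvd a * d - c * b" by simp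
  with assms show "is_unit k" by simp
qed

section \<open>Reduced fractions as Farey vertices\<close>

lemma farey_vertex_eq_iff:
  assumes "coprime a b" "coprime c d"
  shows "farey_vertex a b = farey_vertex c d \<longleftrightarrow> a * d = b * c"
proof -
  have "(of_int a / of_int b = (of_int c / of_int d :: rat)) \<longleftrightarrow> a * d = b * c" if "b \<noteq> 0" "d \<noteq> 0"
    using that by (simp add: frac_eq_eq mult.commute flip: of_int_mult)
  with assms show ?thesis
    by (auto simp: farey_vertex_def)
qed

lemma farey_vertex_cases:
  obtains a b where "coprime a b" "z = farey_vertex a b"
proof (cases z)
  case None
  then show thesis using that[of 1 0] by (simp add: farey_vertex_def)
next
  case (Some q)
  obtain a b where ab: "quotient_of q = (a, b)" by force
  then show thesis
    using that[of a b] Some quotient_of_coprime[OF ab] quotient_of_denom_pos[OF ab] quotient_of_div[OF ab]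
    by (simp add: farey_vertex_def)
qed

text \<open>Adjacency only asks for some pair of reduced representatives. Any other pair differs by
  signs, which the absolute value absorbs.\<close>

lemma farey_adj_vertex_iff:
  assumes "coprime a b" "coprime c d"
  shows "farey_adj (farey_vertex a b) (farey_vertex c d) \<longleftrightarrow> \<bar>a * d - b * c\<bar> = 1"
proof
  assume "farey_adj (farey_vertex a b) (farey_vertex c d)"
  then obtain a' b' c' d' where *: "coprime a' b'" "coprime c' d'"
      "farey_vertex a b = farey_vertex a' b'" "farey_vertex c d = farey_vertex c' d'"
      "\<bar>a' * d' - b' * c'\<bar> = 1"
    unfolding farey_adj_def by blast
  obtain s where s: "\<bar>s\<bar> = 1" "a' = s * a" "b' = s * b"
    using proportional_coprime_eq_sign[of a b a' b'] farey_vertex_eq_iff * assms by metis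
  obtain t where t: "\<bar>t\<bar> = 1" "c' = t * c" "d' = t * d"
    using proportional_coprime_eq_sign[of c d c' d'] farey_vertex_eq_iff * assms by metis
  have "a' * d' - b' * c' = s * t * (a * d - b * c)"
    by (simp add: s t algebra_simps)
  with *(5) s(1) t(1) show "\<bar>a * d - b * c\<bar> = 1"
    by (simp add: abs_mult)
qed (use assms in \<open>auto simp: farey_adj_def\<close>)

section \<open>Moebius maps as linear maps on reduced fractions\<close>

lemma mobius_farey_vertex:
  assumes "A \<in> SL2Z" "coprime a b"
  shows "mobius A (farey_vertex a b) =
    farey_vertex (A $ 1 $ 1 * a + A $ 1 $ 2 * b) (A $ 2 $ 1 * a + A $ 2 $ 2 * b)"
proof (cases "b = 0")
  case True
  with assms(2) have "a = 1 \<or> a = -1" by auto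
  with True show ?thesis
    by (auto simp: mobius_def farey_vertex_def)
next
  case False
  then have "of_int (A $ 2 $ 1) * (of_int a / of_int b) + (of_int (A $ 2 $ 2) :: rat) =
      of_int (A $ 2 $ 1 * a + A $ 2 $ 2 * b) / of_int b"
    "of_int (A $ 1 $ 1) * (of_int a / of_int b) + (of_int (A $ 1 $ 2) :: rat) =
      of_int (A $ 1 $ 1 * a + A $ 1 $ 2 * b) / of_int b"
    by (simp_all add: field_simps)
  with False show ?thesis
    by (simp add: mobius_def farey_vertex_def Let_def del: of_int_add of_int_mult)
qed

lemma SL2Z_det: "A \<in> SL2Z \<longleftrightarrow> A $ 1 $ 1 * A $ 2 $ 2 - A $ 1 $ 2 * A $ 2 $ 1 = 1"
  by (simp add: SL2Z_def det_2)

lemma SL2Z_coprime: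
  assumes "A \<in> SL2Z" "coprime a b"
  shows "coprime (A $ 1 $ 1 * a + A $ 1 $ 2 * b) (A $ 2 $ 1 * a + A $ 2 $ 2 * b)"
proof -
  obtain x y where "x * a + y * b = 1"
    using assms(2) bezout_int[of a b] by (auto simp: coprime_iff_gcd_eq_1)
  \<comment> \<open>The Bezout row \<open>(x, y)\<close> is multiplied by the inverse of
    \<open>A\<close>, which gives Bezout coefficients for the image vector.\<close>
  with assms(1) have "(A $ 1 $ 1 * a + A $ 1 $ 2 * b) * (x * A $ 2 $ 2 - y * A $ 2 $ 1)
     - (x * A $ 1 $ 2 - y * A $ 1 $ 1) * (A $ 2 $ 1 * a + A $ 2 $ 2 * b) = 1"
    unfolding SL2Z_det by algebra
  then show ?thesis by (rule coprime_if_det_eq_1)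
qed

lemma mobius_mult:
  assumes "A \<in> SL2Z" "B \<in> SL2Z"
  shows "mobius B (mobius A z) = mobius (B ** A) z"
proof -
  obtain a b where ab: "coprime a b" "z = farey_vertex a b"
    by (rule farey_vertex_cases)
  have BA: "B ** A \<in> SL2Z" using assms by (simp add: SL2Z_def det_mul)
  show ?thesis
    unfolding ab(2) mobius_farey_vertex[OF assms(1) ab(1)] mobius_farey_vertex[OF BA ab(1)]
      mobius_farey_vertex[OF assms(2) SL2Z_coprime[OF assms(1) ab(1)]]
    by (simp add: matrix_matrix_mult_def UNIV_2 algebra_simps)
qed

lemma orbit_subset:
  assumes "w \<in> orbit v"
  shows "orbit w \<subseteq> orbit v"
proof -
  obtain A where A: "A \<in> SL2Z" "w = map (mobius A) v"
    using assms by (auto simp: orbit_def)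
  have "map (mobius B) w \<in> orbit v" if "B \<in> SL2Z" for B
  proof -
    have "B ** A \<in> SL2Z" using A that by (simp add: SL2Z_def det_mul)
    moreover have "map (mobius B) w = map (mobius (B ** A)) v"
      using A that by (simp add: mobius_mult)
    ultimately show ?thesis by (auto simp: orbit_def)
  qed
  then show ?thesis by (auto simp: orbit_def[of w])
qed

lemma mobius_mat_1: "mobius (mat 1) z = z"
  by (cases z) (simp_all add: mobius_def mat_def)

lemma mat_1_SL2Z: "mat 1 \<in> SL2Z"
  by (simp add: SL2Z_def)

lemma orbit_refl: "v \<in> orbit v"
  unfolding orbit_def by (rule image_eqI[OF _ mat_1_SL2Z]) (simp add: mobius_mat_1 map_idI)

subsection \<open>Normalised lifts\<close>

definition frieze_of :: "(int \<Rightarrow> int) \<Rightarrow> (int \<Rightarrow> int) \<Rightarrow> int \<Rightarrow> int \<Rightarrow> int" where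
  "frieze_of a b = (\<lambda>i j. a j * b i - b j * a i)"

text \<open>Arbitrary reduced representatives have consecutive determinants \<open>s i\<close>, each
  a sign. Rescaling by signs \<open>e i\<close> with \<open>e (i + 1) = s i * e i\<close> turns
  every determinant into a square of a sign.\<close>

lemma normalised_lift_exists:
  assumes "\<And>i. farey_adj (v i) (v (i + 1))"
  obtains a b where "normalised_lift v a b"
proof -
  have "\<exists>p q. coprime p q \<and> v i = farey_vertex p q" for i
    using farey_vertex_cases[of "v i"] by metis
  then obtain p q where pq: "\<And>i. coprime (p i) (q i)" "\<And>i. v i = farey_vertex (p i) (q i)"
    by metis
  define s where "s i = p i * q (i+1) - q i * p (i+1)" for i
  have s: "\<bar>s i\<bar> = 1" for i
    using assms[of i] pq farey_adj_vertex_iff by (simp add: s_def)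
  obtain e where e: "\<And>i. \<bar>e i\<bar> = 1" "\<And>i. e (i + 1) = s i * e i"
    using int_recursion_sign[of s] s by blast
  have unit: "is_unit (e i)" for i using e(1) by simp
  have sq: "e i * e i = 1" "s i * s i = 1" for i
    using e(1)[of i] s[of i] by (metis abs_mult_self_eq mult_1)+
  have "coprime (e i * p i) (e i * q i)" for i
    using pq(1) unit[of i] by (simp add: is_unit_left_imp_coprime is_unit_right_imp_coprime)
  moreover have "v i = farey_vertex (e i * p i) (e i * q i)" for i
    using e(1)[of i] by (auto simp: pq farey_vertex_def)
  moreover have "e i * p i * (e (i+1) * q (i+1)) - e (i+1) * p (i+1) * (e i * q i) = 1" for i
  proof -
    have "e i * p i * (e (i+1) * q (i+1)) - e (i+1) * p (i+1) * (e i * q i)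
        = (e i * e i) * (s i * s i)"
      unfolding e(2) by (subst (3) s_def) (simp add: algebra_simps)
    then show ?thesis by (simp add: sq)
  qed
  ultimately have "normalised_lift v (\<lambda>i. e i * p i) (\<lambda>i. e i * q i)"
    by (simp add: normalised_lift_def)
  then show thesis by (rule that)
qed

text \<open>Each vertex fixes its vector up to a sign; equal determinants of consecutive vectors
  force neighbouring signs to agree.\<close>

lemma normalised_lift_unique:
  assumes "normalised_lift v a b" "normalised_lift v c d"
  obtains s where "\<bar>s\<bar> = 1" "\<And>i. c i = s * a i" "\<And>i. d i = s * b i"
proof -
  have "\<exists>s. \<bar>s\<bar> = 1 \<and> c i = s * a i \<and> d i = s * b i" for i
    using assms farey_vertex_eq_iff[of "a i" "b i" "c i" "d i"]
      proportional_coprime_eq_sign[of "a i" "b i" "c i" "d i"]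
    unfolding normalised_lift_def by metis
  then obtain s where s: "\<And>i. \<bar>s i\<bar> = 1" "\<And>i. c i = s i * a i" "\<And>i. d i = s i * b i"
    by metis
  have "s (i + 1) = s i" for i
  proof -
    have "a i * b (i+1) - a (i+1) * b i = 1" "c i * d (i+1) - c (i+1) * d i = 1"
      using assms by (auto simp: normalised_lift_def)
    then have "s i * s (i + 1) = 1"
      unfolding s by algebra
    with s(1)[of i] show ?thesis
      by (auto simp: abs_if split: if_splits)
  qed
  then have "s i = s 0" for i by (rule int_shift_invariant_const)
  with s that show thesis by metis
qed

text \<open>The entries are quadratic in the lift, so the global sign cancels: the tiling itself,
  not just its class, depends only on the path.\<close>

lemma frieze_of_normalised_lift_unique:
  assumes "normalised_lift v a b" "normalised_lift v c d"
  shows "frieze_of c d = frieze_of a b"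
proof -
  obtain s where s: "\<bar>s\<bar> = 1" "\<And>i. c i = s * a i" "\<And>i. d i = s * b i"
    using normalised_lift_unique[OF assms] by blast
  have "s * s = 1" using s(1) by (metis abs_mult_self_eq mult_1)
  then show ?thesis
    unfolding frieze_of_def s fun_eq_iff by algebra
qed

lemma normalised_lift_mobius:
  assumes "normalised_lift v a b" "A \<in> SL2Z"
  defines "c \<equiv> \<lambda>i. A $ 1 $ 1 * a i + A $ 1 $ 2 * b i"
    and "d \<equiv> \<lambda>i. A $ 2 $ 1 * a i + A $ 2 $ 2 * b i"
  shows "normalised_lift (\<lambda>i. mobius A (v i)) c d" "frieze_of c d = frieze_of a b"
proof -
  have det: "A $ 1 $ 1 * A $ 2 $ 2 - A $ 1 $ 2 * A $ 2 $ 1 = 1"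
    using assms(2) by (simp add: SL2Z_det)
  have cd: "c i * d j - c j * d i = a i * b j - a j * b i" for i j
    unfolding c_def d_def using det by algebra
  have "coprime (c i) (d i)" "mobius A (v i) = farey_vertex (c i) (d i)" for i
    using assms(1,2) unfolding c_def d_def
    by (simp_all only: normalised_lift_def mobius_farey_vertex SL2Z_coprime)
  then show "normalised_lift (\<lambda>i. mobius A (v i)) c d"
    using assms(1) by (simp add: normalised_lift_def cd)
  show "frieze_of c d = frieze_of a b"
    using cd unfolding frieze_of_def fun_eq_iff by (simp add: algebra_simps)
qed

text \<open>Both tilings have entry 1 at \<open>(1, 0)\<close>, which excludes that one is the
  negative of the other.\<close>

lemma plus_minus_frieze_of_inject:
  assumes "plus_minus (frieze_of a b) = plus_minus (frieze_of c d)"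
    and "a 0 * b 1 - a 1 * b 0 = 1" "c 0 * d 1 - c 1 * d 0 = 1"
  shows "frieze_of a b = frieze_of c d"
proof -
  have "frieze_of a b \<in> plus_minus (frieze_of c d)"
    using assms(1) by (auto simp: plus_minus_def)
  moreover have "frieze_of a b 1 0 = 1" "frieze_of c d 1 0 = 1"
    using assms by (simp_all add: frieze_of_def mult.commute)
  ultimately show ?thesis by (auto simp: plus_minus_def)
qed

lemma eq_frieze_of_SL2Z:
  assumes "frieze_of a b = frieze_of c d"
    and "a 0 * b 1 - a 1 * b 0 = 1" "c 0 * d 1 - c 1 * d 0 = 1"
  obtains A where "A \<in> SL2Z" "\<And>i. c i = A $ 1 $ 1 * a i + A $ 1 $ 2 * b i"
    "\<And>i. d i = A $ 2 $ 1 * a i + A $ 2 $ 2 * b i"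
proof -
  \<comment> \<open>With the vectors at 0 and 1 as columns of matrices \<open>U\<close> and
    \<open>V\<close> for the two lifts, this is \<open>V\<close> times the inverse of
    \<open>U\<close>.\<close>
  define A :: "int^2^2" where "A = vector [vector [c 0 * b 1 - c 1 * b 0, a 0 * c 1 - a 1 * c 0],
     vector [d 0 * b 1 - d 1 * b 0, a 0 * d 1 - a 1 * d 0]]"
  have A: "A $ 1 $ 1 = c 0 * b 1 - c 1 * b 0" "A $ 1 $ 2 = a 0 * c 1 - a 1 * c 0"
    "A $ 2 $ 1 = d 0 * b 1 - d 1 * b 0" "A $ 2 $ 2 = a 0 * d 1 - a 1 * d 0"
    by (simp_all add: A_def)
  have "A \<in> SL2Z"
    unfolding SL2Z_det A using assms(2,3) by algebra
  moreover have "c i = A $ 1 $ 1 * a i + A $ 1 $ 2 * b i"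
    "d i = A $ 2 $ 1 * a i + A $ 2 $ 2 * b i" for i
  proof -
    \<comment> \<open>Rows 0 and 1 of the tiling hold, up to sign, the coordinates of the vector at
      \<open>i\<close> in the basis of the vectors at 0 and 1. Equal tilings thus have equal
      coordinates.\<close>
    have "a i * b 0 - b i * a 0 = c i * d 0 - d i * c 0" "a i * b 1 - b i * a 1 = c i * d 1 - d i * c 1"
      using fun_cong[OF fun_cong[OF assms(1)]] unfolding frieze_of_def by blast+
    then show "c i = A $ 1 $ 1 * a i + A $ 1 $ 2 * b i" "d i = A $ 2 $ 1 * a i + A $ 2 $ 2 * b i"
      unfolding A using assms(2,3) by algebra+
  qed
  ultimately show thesis by (rule that)
qed

subsection \<open>Tame tilings\<close>

lemma det_vector_3:
  "det (vector [vector [a, b, c], vector [d, e, f], vector [g, h, k]] :: 'a::comm_ring_1^3^3) =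
     a * e * k + b * f * g + c * d * h - a * f * h - b * d * k - c * e * g"
  by (simp add: det_3)

lemma SL2_tiling_transpose: "SL2_tiling M \<Longrightarrow> SL2_tiling (\<lambda>i j. M j i)"
  by (simp add: SL2_tiling_def mult.commute)

lemma tame_transpose: "tame M \<Longrightarrow> tame (\<lambda>i j. M j i)"
  unfolding tame_def det_vector_3 by (simp add: algebra_simps)

lemma SL2_tiling_uminus: "SL2_tiling M \<Longrightarrow> SL2_tiling (\<lambda>i j. - M i j)"
  by (simp add: SL2_tiling_def)

lemma tame_uminus: "tame M \<Longrightarrow> tame (\<lambda>i j. - M i j)"
  unfolding tame_def det_vector_3 by (simp add: algebra_simps)

lemma tame_frieze_uminus: "tame_frieze n M \<Longrightarrow> tame_frieze n (\<lambda>i j. - M i j)"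
  by (simp add: tame_frieze_def SL2_tiling_uminus tame_uminus)

lemma tame_SL2_tiling_row_recurrence:
  assumes "SL2_tiling M" "tame M"
  obtains e where "\<And>j. M i j + M (i+2) j = e * M (i+1) j"
proof -
  \<comment> \<open>By the tiling condition, \<open>(1, -p j, 1)\<close> is the cross product of columns \<open>j\<close> and \<open>j + 1\<close>
    in rows \<open>i, i + 1, i + 2\<close>.\<close>
  define p where "p j = M i j * M (i+2) (j+1) - M i (j+1) * M (i+2) j" for j
  have t1: "M i j * M (i+1) (j+1) - M i (j+1) * M (i+1) j = 1" for j
    using assms(1) by (simp add: SL2_tiling_def)
  have t2: "M (i+1) j * M (i+2) (j+1) - M (i+1) (j+1) * M (i+2) j = 1" for j
    using assms(1)[unfolded SL2_tiling_def, rule_format, of "i+1" j] by (simp add: add.assoc)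
  have A: "M i j + M (i+2) j = p j * M (i+1) j"
    and B: "M i (j+1) + M (i+2) (j+1) = p j * M (i+1) (j+1)" for j
    unfolding p_def using t1[of j] t2[of j] by algebra+
  \<comment> \<open>Tameness enters here: the vanishing determinant makes column
    \<open>j + 2\<close> orthogonal to the same cross product.\<close>
  have C: "M i (j+2) + M (i+2) (j+2) = p j * M (i+1) (j+2)" for j
    using assms(2)[unfolded tame_def det_vector_3, rule_format, of i j] t1[of j] t2[of j]
    unfolding p_def by algebra
  \<comment> \<open>Both coefficients give the same multiples of the middle entries in columns
    \<open>j + 1\<close> and \<open>j + 2\<close>; by the tiling condition these two entries have an
    integer combination equal to 1.\<close>
  have "p (j+1) = p j" for j
  proof -
    have j: "j + 1 + 1 = j + 2" by simp
    show ?thesis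
      using A[of "j+1"] B[of j] B[of "j+1", unfolded j] C[of j] t2[of "j+1", unfolded j] by algebra
  qed
  then have "p j = p 0" for j by (rule int_shift_invariant_const)
  then show thesis using that[of "p 0"] A by metis
qed

text \<open>Induction for second-order recurrences that can be run in both directions: two
  consecutive values propagate to either side.\<close>

lemma int_two_step_induct:
  fixes i :: int
  assumes "P 0" "P 1" "\<And>i. P i \<Longrightarrow> P (i+1) \<Longrightarrow> P (i+2)" "\<And>i. P (i+1) \<Longrightarrow> P (i+2) \<Longrightarrow> P i"
  shows "P i"
proof -
  have "P i \<and> P (i+1)"
  proof (induction i rule: int_induct[where k = 0])
    case (step1 i)
    then show ?case using assms(3)[of i] by (simp add: add.assoc)
  next
    case (step2 i)
    then show ?case using assms(4)[of "i - 1"] by (simp add: add.commute)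
  qed (use assms in simp)
  then show ?thesis ..
qed

locale tame_SL2_tiling_zero_diagonal =
  fixes M :: "int \<Rightarrow> int \<Rightarrow> int"
  assumes tiling: "SL2_tiling M" and tame: "tame M" and diagonal: "M i i = 0"
begin

lemma subdiagonal_mult: "M i (i+1) * M (i+1) i = -1"
  using tiling[unfolded SL2_tiling_def, rule_format, of i i] diagonal by simp

lemma subdiagonal_abs: "\<bar>M (i+1) i\<bar> = 1"
  using subdiagonal_mult[of i] by (metis abs_minus_cancel abs_mult abs_one abs_zmult_eq_1 mult.commute)

lemma superdiagonal: "M i (i+1) = - M (i+1) i"
  using subdiagonal_mult[of i] subdiagonal_abs[of i] by (auto simp: abs_if split: if_splits)

lemma subdiagonal_const: "M (i+1) i = M 1 0"
proof -
  have "M (i+1+1) (i+1) = M (i+1) i" for i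
  proof -
    obtain e where "\<And>j. M i j + M (i+2) j = e * M (i+1) j"
      using tame_SL2_tiling_row_recurrence[OF tiling tame] by blast
    \<comment> \<open>In column \<open>i + 1\<close> the middle row has its diagonal zero, so the
      entries above and below it are opposite.\<close>
    from this[of "i+1"] show ?thesis
      using superdiagonal[of i] diagonal by (simp add: add.assoc)
  qed
  from int_shift_invariant_const[of "\<lambda>i. M (i+1) i", OF this] show ?thesis by simp
qed

lemma row_recurrence:
  assumes "M 1 0 = 1"
  shows "M i j + M (i+2) j = M (i+2) i * M (i+1) j"
proof -
  obtain e where e: "\<And>j. M i j + M (i+2) j = e * M (i+1) j"
    using tame_SL2_tiling_row_recurrence[OF tiling tame] by blast
  \<comment> \<open>Column \<open>i\<close> has 0 in row \<open>i\<close> and 1 in row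
    \<open>i + 1\<close>, so it displays the coefficient.\<close>
  from e[of i] have "e = M (i+2) i"
    using subdiagonal_const assms diagonal by simp
  with e show ?thesis by simp
qed

text \<open>Apply the row recurrence to the transpose and read the coefficient off row
  \<open>i + 2\<close>, whose entry in column \<open>i + 1\<close> is 1. It is the coefficient of
  the rows.\<close>

lemma column_recurrence:
  assumes "M 1 0 = 1"
  shows "M j i + M j (i+2) = M (i+2) i * M j (i+1)"
proof -
  obtain e where e: "\<And>j. M j i + M j (i+2) = e * M j (i+1)"
    using tame_SL2_tiling_row_recurrence[OF SL2_tiling_transpose[OF tiling] tame_transpose[OF tame]]
    by blast
  from e[of "i+2"] have "e = M (i+2) i"
    using subdiagonal_const[of "i+1"] assms diagonal by (simp add: add.assoc)
  with e show ?thesis by simp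
qed

text \<open>For fixed \<open>j\<close> both sides satisfy the same three-term recurrence in
  \<open>i\<close>, the right one through the columns of rows 0 and 1. They agree at
  \<open>i = 0\<close> and \<open>i = 1\<close>.\<close>

lemma eq_frieze_of:
  assumes "M 1 0 = 1"
  shows "M = frieze_of (\<lambda>j. M 1 j) (\<lambda>j. - M 0 j)"
proof -
  have "M i j = M 0 j * M 1 i - M 1 j * M 0 i" for i j
  proof (induction i rule: int_two_step_induct)
    case 1
    show ?case using assms diagonal by simp
  next
    case 2
    show ?case using assms diagonal superdiagonal[of 0] by simp
  next
    case (3 i)
    with row_recurrence[OF assms, of i j] column_recurrence[OF assms, of 0 i]
      column_recurrence[OF assms, of 1 i]
    show ?case by algebra
  next
    case (4 i)
    with row_recurrence[OF assms, of i j] column_recurrence[OF assms, of 0 i]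
      column_recurrence[OF assms, of 1 i]
    show ?case by algebra
  qed
  then show ?thesis
    unfolding frieze_of_def fun_eq_iff by (simp add: algebra_simps)
qed

end

text \<open>The 2 by 2 minor factors as the determinant of the vectors at \<open>i, i + 1\<close>
  times that of the vectors at \<open>j, j + 1\<close>.\<close>

lemma SL2_tiling_frieze_of:
  assumes "\<And>i. a i * b (i+1) - a (i+1) * b i = 1"
  shows "SL2_tiling (frieze_of a b)"
  unfolding SL2_tiling_def
proof (intro allI)
  fix i j
  show "frieze_of a b i j * frieze_of a b (i+1) (j+1) - frieze_of a b i (j+1) * frieze_of a b (i+1) j = 1"
    using assms[of i] assms[of j] unfolding frieze_of_def by algebra
qed

text \<open>The entries are a bilinear form in vectors of a plane, so the matrix has rank at most
  2.\<close>

lemma tame_frieze_of: "tame (frieze_of a b)"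
  unfolding tame_def det_vector_3 frieze_of_def by algebra

subsection \<open>Clockwise order\<close>

text \<open>Clearing the denominator \<open>b\<close> leaves the numerator
  \<open>b + \<i> a\<close>, which is \<open>\<i>\<close> times the conjugate of
  \<open>a + \<i> b\<close>. The formula also covers infinity, where \<open>b = 0\<close> and
  \<open>a\<close> is a sign.\<close>

lemma to_circle_farey_vertex:
  assumes "coprime a b"
  shows "to_circle (real_point (farey_vertex a b)) =
    \<i> * cnj (Complex (of_int a) (of_int b)) / Complex (of_int a) (of_int b)"
proof (cases "b = 0")
  case True
  with assms have "a = 1 \<or> a = -1" by auto
  with True show ?thesis
    by (auto simp: to_circle_def farey_vertex_def complex_eq_iff Complex_eq)
next
  case False
  have "to_circle (real_point (farey_vertex a b)) =
    (\<i> * (of_int a / of_int b) + 1) / (of_int a / of_int b + \<i>)"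
    using False by (simp add: to_circle_def farey_vertex_def of_rat_divide)
  also have "\<dots> = (\<i> * of_int a + of_int b) / (of_int a + \<i> * of_int b)"
  proof -
    have "\<i> * (of_int a / of_int b) + 1 = (\<i> * of_int a + of_int b) / (of_int b :: complex)"
      "of_int a / of_int b + \<i> = (of_int a + \<i> * of_int b) / (of_int b :: complex)"
      using False by (simp_all add: field_simps)
    with False show ?thesis by simp
  qed
  finally show ?thesis
    by (simp add: Complex_eq algebra_simps)
qed

text \<open>The circle point determines \<open>w\<close> only up to a real factor, so
  \<open>r\<close> may be negative. After rotation by the half angle, \<open>w\<close> equals its
  conjugate.\<close>

lemma half_angle:
  fixes w :: complex
  assumes "w \<noteq> 0" "\<i> * cnj w / w = cis \<alpha>"
  obtains r where "r \<noteq> 0" "w = of_real r * cis (pi/4 - \<alpha>/2)"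
proof -
  define \<theta> where "\<theta> = pi/4 - \<alpha>/2"
  have "cis \<alpha> = \<i> * cis (-2*\<theta>)"
    unfolding \<theta>_def by (simp flip: cis_pi_half add: cis_mult field_simps)
  then have "cnj w = w * cis (-2*\<theta>)"
    using assms by (simp add: field_simps)
  then have "cnj (w * cis (-\<theta>)) = w * (cis (-2*\<theta>) * cis \<theta>)"
    by (simp add: cis_cnj)
  also have "\<dots> = w * cis (-\<theta>)"
    by (simp add: cis_mult)
  finally have "w * cis (-\<theta>) \<in> \<real>"
    by (simp only: Reals_cnj_iff)
  then obtain r where r: "w * cis (-\<theta>) = of_real r" by (auto simp: Reals_def)
  then have "w = of_real r * cis \<theta>"
    by (metis cis_mult cis_zero add.left_inverse mult.assoc mult.right_neutral)
  with assms(1) that show thesis by (auto simp: \<theta>_def)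
qed

lemma Im_cnj_mult_polar:
  "Im (cnj (of_real r * cis \<alpha>) * (of_real s * cis \<beta>)) = r * s * sin (\<beta> - \<alpha>)"
  by (simp add: sin_diff algebra_simps)

text \<open>\<open>Im (cnj w * z)\<close> is the determinant of \<open>w\<close> and
  \<open>z\<close> as plane vectors. Clockwise angles on the circle become increasing half angles
  within an open half-turn, where the sign of a determinant is that of a sine times the real
  factors.\<close>

lemma circle_clockwise_doubling_iff:
  fixes w1 w2 w3 :: complex
  assumes "Im (cnj w1 * w2) > 0" "Im (cnj w2 * w3) > 0"
  shows "circle_clockwise (\<i> * cnj w1 / w1) (\<i> * cnj w2 / w2) (\<i> * cnj w3 / w3)
    \<longleftrightarrow> Im (cnj w1 * w3) > 0"
proof -
  have nz: "w1 \<noteq> 0" "w2 \<noteq> 0" "w3 \<noteq> 0" using assms by auto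
  show ?thesis
  proof
    assume "circle_clockwise (\<i> * cnj w1 / w1) (\<i> * cnj w2 / w2) (\<i> * cnj w3 / w3)"
    then obtain \<alpha> \<beta> \<gamma> where cis: "\<i> * cnj w1 / w1 = cis \<alpha>" "\<i> * cnj w2 / w2 = cis \<beta>"
        "\<i> * cnj w3 / w3 = cis \<gamma>" and ord: "\<alpha> > \<beta>" "\<beta> > \<gamma>" "\<gamma> > \<alpha> - 2 * pi"
      unfolding circle_clockwise_def by blast
    obtain r1 r2 r3 where r: "w1 = of_real r1 * cis (pi/4 - \<alpha>/2)"
        "w2 = of_real r2 * cis (pi/4 - \<beta>/2)" "w3 = of_real r3 * cis (pi/4 - \<gamma>/2)"
      using half_angle nz cis by metis
    \<comment> \<open>All three differences of half angles lie strictly between 0 and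
      \<open>pi\<close>.\<close>
    have "sin ((pi/4 - \<beta>/2) - (pi/4 - \<alpha>/2)) > 0" "sin ((pi/4 - \<gamma>/2) - (pi/4 - \<beta>/2)) > 0"
      and s: "sin ((pi/4 - \<gamma>/2) - (pi/4 - \<alpha>/2)) > 0"
      using ord by (auto intro!: sin_gt_zero simp: field_simps)
    then have "r1 * r2 > 0" "r2 * r3 > 0"
      using assms unfolding r Im_cnj_mult_polar by (auto simp: zero_less_mult_iff)
    then have "r1 * r3 > 0" by (auto simp: zero_less_mult_iff)
    with s show "Im (cnj w1 * w3) > 0"
      unfolding r Im_cnj_mult_polar by simp
  next
    assume pos: "Im (cnj w1 * w3) > 0"
    define \<theta> where "\<theta> = Arg w1"
    define \<phi> where "\<phi> = Arg (cnj w1 * w2)"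
    define \<psi> where "\<psi> = Arg (cnj w1 * w3)"
    have \<phi>: "0 < \<phi>" "\<phi> < pi" and \<psi>: "0 < \<psi>" "\<psi> < pi"
      using assms(1) pos unfolding \<phi>_def \<psi>_def by (simp_all only: Arg_lt_pi[THEN iffD2])
    have w1: "w1 = of_real (norm w1) * cis \<theta>"
      by (simp add: \<theta>_def Arg_eq rcis_cmod_Arg flip: rcis_def)
    \<comment> \<open>Arguments are measured from \<open>w1\<close>; then \<open>w2\<close> and
      \<open>w3\<close> lie in the open upper half-plane, and their mutual determinant orders
      them.\<close>
    have other: "w = of_real (norm w) * cis (\<theta> + Arg (cnj w1 * w))" if "w \<noteq> 0" for w
    proof -
      have "cnj w1 * w = of_real (norm w1 * norm w) * cis (Arg (cnj w1 * w))"
        using rcis_cmod_Arg[of "cnj w1 * w"] by (simp add: rcis_def norm_mult)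
      moreover have "cnj w1 = of_real (norm w1) * cis (-\<theta>)"
        by (subst w1) (simp add: cis_cnj)
      ultimately have "cis (-\<theta>) * w = of_real (norm w) * cis (Arg (cnj w1 * w))"
        using nz(1) by (simp add: mult.assoc)
      then have "cis \<theta> * (cis (-\<theta>) * w) = of_real (norm w) * cis (\<theta> + Arg (cnj w1 * w))"
        by (simp flip: cis_mult)
      then show ?thesis by (simp add: cis_mult flip: mult.assoc)
    qed
    have w2: "w2 = of_real (norm w2) * cis (\<theta> + \<phi>)" and w3: "w3 = of_real (norm w3) * cis (\<theta> + \<psi>)"
      using other nz by (simp_all add: \<phi>_def \<psi>_def)
    have "sin (\<psi> - \<phi>) > 0"
    proof -
      have "0 < (norm w2 * norm w3) * sin (\<psi> - \<phi>)"
        using assms(2) Im_cnj_mult_polar[of "norm w2" "\<theta> + \<phi>" "norm w3" "\<theta> + \<psi>"] w2 w3 by simp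
      then show ?thesis using nz by (metis mult_pos_pos zero_less_mult_pos zero_less_norm_iff)
    qed
    then have lt: "\<phi> < \<psi>"
      using \<phi> \<psi> sin_ge_zero[of "\<phi> - \<psi>"] sin_minus[of "\<psi> - \<phi>"] by fastforce
    have circ: "\<i> * cnj w / w = cis (pi/2 - 2 * \<tau>)"
      if "w \<noteq> 0" "w = of_real (norm w) * cis \<tau>" for w \<tau>
    proof -
      have "cnj w = of_real (norm w) * cis (-\<tau>)"
        by (subst that(2)) (simp add: cis_cnj)
      then have "\<i> * cnj w = cis (pi/2 - 2 * \<tau>) * (of_real (norm w) * cis \<tau>)"
        by (simp flip: cis_pi_half add: cis_mult algebra_simps)
      also have "\<dots> = cis (pi/2 - 2 * \<tau>) * w" using that(2) by simp
      finally show ?thesis using that(1) by simp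
    qed
    show "circle_clockwise (\<i> * cnj w1 / w1) (\<i> * cnj w2 / w2) (\<i> * cnj w3 / w3)"
      unfolding circle_clockwise_def
      using circ[OF nz(1) w1] circ[OF nz(2) w2] circ[OF nz(3) w3] \<phi> \<psi> lt
      by (intro exI[of _ "pi/2 - 2 * \<theta>"] exI[of _ "pi/2 - 2 * (\<theta> + \<phi>)"]
          exI[of _ "pi/2 - 2 * (\<theta> + \<psi>)"]) auto
  qed
qed

text \<open>Distinctness is part of the equivalence: neighbours differ since their determinant is 1,
  the outer two since theirs is positive.\<close>

lemma clockwise_farey_vertex_iff:
  assumes "coprime a b" "coprime c d" "coprime e f"
    and "a * d - c * b = 1" "c * f - e * d = 1"
  shows "clockwise (real_point (farey_vertex a b)) (real_point (farey_vertex c d))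
      (real_point (farey_vertex e f)) \<longleftrightarrow> a * f - b * e > 0"
proof -
  have Im: "Im (cnj (Complex (of_int x) (of_int y)) * Complex (of_int z) (of_int w)) = of_int (x * w - y * z)"
    for x y z w by simp
  have "circle_clockwise (to_circle (real_point (farey_vertex a b)))
      (to_circle (real_point (farey_vertex c d))) (to_circle (real_point (farey_vertex e f)))
      \<longleftrightarrow> Im (cnj (Complex (of_int a) (of_int b)) * Complex (of_int e) (of_int f)) > 0"
    unfolding to_circle_farey_vertex[OF assms(1)] to_circle_farey_vertex[OF assms(2)]
      to_circle_farey_vertex[OF assms(3)]
    by (rule circle_clockwise_doubling_iff; subst Im) (use assms(4,5) in \<open>simp_all add: mult.commute\<close>)
  moreover have "inj real_point"
    by (rule option.inj_map) (simp add: inj_def)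
  ultimately show ?thesis
    unfolding clockwise_def Im of_int_0_less_iff
    using assms by (auto simp: inj_eq farey_vertex_eq_iff mult.commute)
qed

lemma clockwise_normalised_lift_iff:
  assumes "normalised_lift w a b"
  shows "clockwise (real_point (w (k-1))) (real_point (w k)) (real_point (w (k+1)))
    \<longleftrightarrow> frieze_of a b (k+1) (k-1) > 0"
proof -
  have "a (k-1) * b k - a k * b (k-1) = 1"
    using assms[unfolded normalised_lift_def, THEN conjunct2, rule_format, of "k-1"] by simp
  then have "clockwise (real_point (farey_vertex (a (k-1)) (b (k-1)))) (real_point (farey_vertex (a k) (b k)))
      (real_point (farey_vertex (a (k+1)) (b (k+1)))) \<longleftrightarrow> a (k-1) * b (k+1) - b (k-1) * a (k+1) > 0"
    using assms by (intro clockwise_farey_vertex_iff) (auto simp: normalised_lift_def)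
  with assms show ?thesis
    by (simp add: normalised_lift_def frieze_of_def)
qed

subsection \<open>Closed paths and the map from orbits to friezes\<close>

text \<open>\<open>bi_infinite\<close> reads only the indices below \<open>n\<close>; at
  \<open>i = n\<close> it returns \<open>v ! 0\<close>, so the closing condition is used.\<close>

lemma bi_infinite_of_nat:
  assumes "v ! 0 = v ! n" "i \<le> n"
  shows "bi_infinite n v (int i) = v ! i"
  using assms by (cases "i = n") (simp_all add: bi_infinite_def flip: of_nat_mod)

lemma bi_infinite_Suc:
  assumes "v ! 0 = v ! n" "n > 0"
  shows "bi_infinite n v (k + 1) = v ! (nat (k mod int n) + 1)"
proof -
  define r where "r = nat (k mod int n)"
  have r: "int r = k mod int n" "r < n" using assms(2) by (auto simp: r_def nat_less_iff)
  have "(k + 1) mod int n = (int r + 1) mod int n"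
    unfolding r by (simp add: mod_add_left_eq)
  then have "bi_infinite n v (k + 1) = bi_infinite n v (int (r + 1))"
    by (simp add: bi_infinite_def add.commute)
  with r assms show ?thesis
    using bi_infinite_of_nat[of v n "r+1"] by (simp add: r_def)
qed

lemma bi_infinite_add: "bi_infinite n v (k + int n) = bi_infinite n v k"
  by (simp add: bi_infinite_def)

lemma bi_infinite_map:
  assumes "length v = n + 1" "n > 0"
  shows "bi_infinite n (map f v) k = f (bi_infinite n v k)"
proof -
  have "nat (k mod int n) < n" using assms(2) by (simp add: nat_less_iff)
  with assms(1) show ?thesis by (simp add: bi_infinite_def)
qed

lemma C0_iff_bi_infinite:
  assumes "n > 1"
  shows "v \<in> C0 n \<longleftrightarrow> length v = n + 1 \<and> v ! 0 = v ! n \<and>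
    (\<forall>k. farey_adj (bi_infinite n v k) (bi_infinite n v (k+1))) \<and>
    (\<forall>k. clockwise (real_point (bi_infinite n v (k-1))) (real_point (bi_infinite n v k))
       (real_point (bi_infinite n v (k+1))))" (is "_ \<longleftrightarrow> ?len \<and> ?cl \<and> ?adj \<and> ?clk")
proof (intro iffI; (elim conjE)?)
  assume v: "v \<in> C0 n"
  then have len: ?len and cl: ?cl and adj: "\<And>i. i < n \<Longrightarrow> farey_adj (v ! i) (v ! (i+1))"
    and clk: "\<And>i. i \<in> {1..n} \<Longrightarrow> clockwise (real_point (v ! (i-1))) (real_point (v ! i))
        (real_point (if i = n then v ! 1 else v ! (i+1)))"
    by (auto simp: C0_def closed_path_def)
  have less: "nat (k mod int n) < n" for k using assms by (simp add: nat_less_iff)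
  have ?adj
    using adj[OF less] bi_infinite_Suc[OF cl] assms by (simp add: bi_infinite_def)
  moreover have "clockwise (real_point (bi_infinite n v (k-1))) (real_point (bi_infinite n v k))
       (real_point (bi_infinite n v (k+1)))" for k
  proof -
    \<comment> \<open>The residue is taken of \<open>k - 1\<close>, so that \<open>r + 1\<close>
      runs through 1 to \<open>n\<close>, the indices at which \<open>C0\<close> states the
      order.\<close>
    define r where "r = nat ((k-1) mod int n)"
    have r: "r < n" "int r = (k-1) mod int n" using less assms by (auto simp: r_def)
    have "k mod int n = (int r + 1) mod int n"
      unfolding r mod_add_left_eq by simp
    also have "\<dots> = int ((r + 1) mod n)" by (simp add: zmod_int add.commute)
    finally have "nat (k mod int n) = (r + 1) mod n" by simp
    then have "bi_infinite n v (k+1) = (if r + 1 = n then v ! 1 else v ! (r + 1 + 1))"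
      using bi_infinite_Suc[OF cl, of k] r assms by simp
    moreover have "bi_infinite n v k = v ! (r + 1)"
      using bi_infinite_Suc[OF cl, of "k-1"] assms by (simp add: r_def)
    moreover have "bi_infinite n v (k-1) = v ! r" by (simp add: bi_infinite_def r_def)
    ultimately show ?thesis using clk[of "r+1"] r by simp
  qed
  ultimately show "?len \<and> ?cl \<and> ?adj \<and> ?clk" using len cl by blast
next
  assume len: ?len and cl: ?cl and adj: ?adj and clk: ?clk
  have "farey_adj (v ! i) (v ! (i+1))" if "i < n" for i
    using adj[rule_format, of "int i"] bi_infinite_of_nat[OF cl, of i]
      bi_infinite_of_nat[OF cl, of "i+1"] that by (simp add: add.commute)
  moreover have "clockwise (real_point (v ! (i-1))) (real_point (v ! i))
        (real_point (if i = n then v ! 1 else v ! (i+1)))" if "i \<in> {1..n}" for i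
  proof -
    have "bi_infinite n v (int i + 1) = (if i = n then v ! 1 else v ! (i+1))"
    proof (cases "i = n")
      case True
      then show ?thesis
        using bi_infinite_add[of n v 1] bi_infinite_of_nat[OF cl, of 1] assms by (simp add: add.commute)
    next
      case False
      then show ?thesis
        using bi_infinite_of_nat[OF cl, of "i+1"] that by (simp add: add.commute)
    qed
    moreover have "bi_infinite n v (int i - 1) = v ! (i-1)"
      using bi_infinite_of_nat[OF cl, of "i-1"] that by (auto simp: of_nat_diff)
    ultimately show ?thesis
      using clk[rule_format, of "int i"] bi_infinite_of_nat[OF cl, of i] that by simp
  qed
  ultimately show "v \<in> C0 n" using len cl by (simp add: C0_def closed_path_def)
qed

lemma normalised_lift_farey_adj:
  assumes "normalised_lift w a b"
  shows "farey_adj (w k) (w (k+1))"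
  using assms by (simp add: normalised_lift_def farey_adj_vertex_iff mult.commute)

lemma C0_iff_normalised_lift:
  assumes "n > 1" "normalised_lift (bi_infinite n v) a b"
  shows "v \<in> C0 n \<longleftrightarrow> length v = n + 1 \<and> v ! 0 = v ! n \<and> (\<forall>k. frieze_of a b (k+1) (k-1) > 0)"
  using C0_iff_bi_infinite[OF assms(1), of v] normalised_lift_farey_adj[OF assms(2)]
    clockwise_normalised_lift_iff[OF assms(2)] by simp

lemma C0_normalised_lift_exists:
  assumes "n > 1" "v \<in> C0 n"
  obtains a b where "normalised_lift (bi_infinite n v) a b"
  using assms normalised_lift_exists C0_iff_bi_infinite by metis

section \<open>Quiddity of a class, and the two directions of the bijection\<close>

lemma quiddity_uminus:
  assumes "\<And>k. M (k+1) k = 1"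
  shows "quiddity (\<lambda>i j. - M i j) = quiddity M"
  using assms by (simp add: quiddity_def fun_eq_iff)

lemma plus_minus_FR0_iff:
  assumes "tame_frieze n M" "\<And>k. M (k+1) k = 1"
  shows "plus_minus M \<in> FR0 n \<longleftrightarrow> (\<forall>k. M (k+1) (k-1) > 0)"
proof -
  have "plus_minus M \<in> FR n" using assms(1) by (auto simp: FR_def)
  moreover have "quiddity M k = M (k+1) (k-1)" for k
    using assms(2) by (simp add: quiddity_def)
  ultimately show ?thesis
    using quiddity_uminus[of M] assms(2) by (simp add: FR0_def plus_minus_def)
qed

lemma normalised_lift_subdiagonal:
  assumes "normalised_lift w a b"
  shows "frieze_of a b (k+1) k = 1"
  using assms by (simp add: frieze_of_def normalised_lift_def mult.commute)

text \<open>The vectors at \<open>k\<close> and \<open>k + n\<close> represent the same vertex. They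
  may differ by a sign, but their determinant vanishes.\<close>

lemma tame_frieze_normalised_lift:
  assumes "normalised_lift (bi_infinite n v) a b"
  shows "tame_frieze n (frieze_of a b)"
proof -
  have "frieze_of a b (k + int n) k = 0" for k
    using assms bi_infinite_add[of n v k]
      farey_vertex_eq_iff[of "a (k + int n)" "b (k + int n)" "a k" "b k"]
    by (simp add: normalised_lift_def frieze_of_def mult.commute)
  moreover have "SL2_tiling (frieze_of a b)"
    using assms by (intro SL2_tiling_frieze_of) (simp add: normalised_lift_def)
  ultimately show ?thesis
    by (simp add: tame_frieze_def tame_frieze_of) (simp add: frieze_of_def)
qed

text \<open>The union in \<open>Phi\<close> is over a single class: a path in the orbit has the
  transformed lift, with the same tiling, and every other lift of it gives that tiling too.\<close>

lemma Phi_orbit: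
  assumes "n > 0" "length v = n + 1" "normalised_lift (bi_infinite n v) a b"
  shows "Phi n (orbit v) = plus_minus (frieze_of a b)"
proof -
  have "plus_minus (frieze_of c d) = plus_minus (frieze_of a b)"
    if w: "w \<in> orbit v" and lift: "normalised_lift (bi_infinite n w) c d" for w c d
  proof -
    obtain A where A: "A \<in> SL2Z" "w = map (mobius A) v"
      using w by (auto simp: orbit_def)
    then have "bi_infinite n w = (\<lambda>i. mobius A (bi_infinite n v i))"
      using bi_infinite_map[OF assms(2,1)] by auto
    with lift have "normalised_lift (\<lambda>i. mobius A (bi_infinite n v i)) c d" by simp
    from frieze_of_normalised_lift_unique[OF normalised_lift_mobius(1)[OF assms(3) A(1)] this]
    show ?thesis by (simp add: normalised_lift_mobius(2)[OF assms(3) A(1)])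
  qed
  then have "{plus_minus (frieze_of c d) | w c d. w \<in> orbit v \<and> normalised_lift (bi_infinite n w) c d}
      = {plus_minus (frieze_of a b)}"
    using orbit_refl assms(3) by blast
  then show ?thesis
    unfolding Phi_def frieze_of_def[symmetric] by simp
qed

text \<open>Injectivity: equal classes give equal tilings, whose lifts differ by a matrix of
  determinant 1, which then carries one path to the other.\<close>

lemma eq_Phi_imp_in_orbit:
  assumes "n > 1" "v \<in> C0 n" "w \<in> C0 n" "Phi n (orbit v) = Phi n (orbit w)"
  shows "w \<in> orbit v"
proof -
  have len: "length v = n + 1" "length w = n + 1" and cl: "v ! 0 = v ! n" "w ! 0 = w ! n"
    using assms C0_iff_bi_infinite by blast+
  obtain a b where ab: "normalised_lift (bi_infinite n v) a b"
    using C0_normalised_lift_exists assms by blast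
  obtain c d where cd: "normalised_lift (bi_infinite n w) c d"
    using C0_normalised_lift_exists assms by blast
  have det: "a 0 * b 1 - a 1 * b 0 = 1" "c 0 * d 1 - c 1 * d 0 = 1"
    using ab cd unfolding normalised_lift_def by (metis add_0)+
  have "plus_minus (frieze_of a b) = plus_minus (frieze_of c d)"
    using assms(1,4) len ab cd by (simp add: Phi_orbit)
  then have "frieze_of a b = frieze_of c d"
    using plus_minus_frieze_of_inject det by blast
  then obtain A where A: "A \<in> SL2Z" "\<And>i. c i = A $ 1 $ 1 * a i + A $ 1 $ 2 * b i"
    "\<And>i. d i = A $ 2 $ 1 * a i + A $ 2 $ 2 * b i"
    using eq_frieze_of_SL2Z det by blast
  have "bi_infinite n w k = mobius A (bi_infinite n v k)" for k
    using ab cd A by (simp add: normalised_lift_def mobius_farey_vertex)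
  then have "w ! i = mobius A (v ! i)" if "i \<le> n" for i
    using bi_infinite_of_nat[OF cl(1) that] bi_infinite_of_nat[OF cl(2) that] by metis
  then have "w = map (mobius A) v"
    using len by (simp add: list_eq_iff_nth_eq)
  with A(1) show ?thesis by (auto simp: orbit_def)
qed

lemma FR0_normalised_lift:
  assumes "n > 1" "S \<in> FR0 n"
  obtains v a b where "v \<in> C0 n" "normalised_lift (bi_infinite n v) a b"
    "S = plus_minus (frieze_of a b)"
proof -
  obtain N where N: "tame_frieze n N" "S = plus_minus N"
    using assms(2) by (auto simp: FR0_def FR_def)
  interpret N: tame_SL2_tiling_zero_diagonal N
    using N(1) by unfold_locales (auto simp: tame_frieze_def)
  \<comment> \<open>Of the two tilings in the class, the one with subdiagonal 1 is chosen.\<close>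
  obtain M where M: "tame_frieze n M" "S = plus_minus M" "M 1 0 = 1"
  proof (cases "N 1 0 = 1")
    case True
    with N that show thesis by blast
  next
    case False
    then have "- N 1 0 = 1" using N.subdiagonal_abs[of 0] by simp
    moreover have "plus_minus N = plus_minus (\<lambda>i j. - N i j)"
      by (auto simp: plus_minus_def)
    ultimately show thesis using that[of "\<lambda>i j. - N i j"] N tame_frieze_uminus by simp
  qed
  interpret M: tame_SL2_tiling_zero_diagonal M
    using M(1) by unfold_locales (auto simp: tame_frieze_def)
  define a b where "a = (\<lambda>j. M 1 j)" and "b = (\<lambda>j. - M 0 j)"
  have M_eq: "M = frieze_of a b"
    unfolding a_def b_def by (rule M.eq_frieze_of[OF M(3)])
  have sub: "M (i+1) i = 1" for i
    using M.subdiagonal_const M(3) by simp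
  have det: "a i * b (i+1) - a (i+1) * b i = 1" for i
    using sub[of i] by (simp add: M_eq frieze_of_def mult.commute)
  have copr: "coprime (a i) (b i)" for i
    using coprime_if_det_eq_1[OF det] .
  define w where "w i = farey_vertex (a i) (b i)" for i
  have per: "w (i + int n) = w i" for i
  proof -
    have "M (i + int n) i = 0" using M(1) by (simp add: tame_frieze_def)
    then show ?thesis
      by (simp add: w_def farey_vertex_eq_iff copr M_eq frieze_of_def mult.commute)
  qed
  \<comment> \<open>One period together with the repeated endpoint.\<close>
  define v where "v = map (\<lambda>k. w (int k)) [0..<n+1]"
  have len: "length v = n + 1" and cl: "v ! 0 = v ! n"
    using per[of 0] by (simp_all add: v_def nth_append)
  have "bi_infinite n v i = w i" for i
  proof -
    have "0 \<le> i mod int n" "i mod int n < int n" using assms(1) by simp_all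
    then have "nat (i mod int n) < n + 1" "0 \<le> i mod int n" by linarith+
    then have bi: "bi_infinite n v i = w (i mod int n)"
      by (simp add: bi_infinite_def v_def del: upt_Suc)
    \<comment> \<open>Periodicity by \<open>n\<close> extends to all integer multiples, negative
      ones included, as shift invariance in \<open>q\<close>.\<close>
    have "w (i mod int n + int n * q) = w (i mod int n)" for q
    proof -
      have "w (i mod int n + int n * (q + 1)) = w (i mod int n + int n * q)" for q
        using per[of "i mod int n + int n * q"] by (simp add: distrib_left add.assoc)
      from int_shift_invariant_const[of "\<lambda>q. w (i mod int n + int n * q)", OF this]
      show ?thesis by simp
    qed
    from this[of "i div int n"] have "w i = w (i mod int n)" by simp
    with bi show ?thesis by simp
  qed
  then have lift: "normalised_lift (bi_infinite n v) a b"
    using copr det by (simp add: normalised_lift_def w_def)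
  moreover have "v \<in> C0 n"
    using C0_iff_normalised_lift[OF assms(1) lift] len cl plus_minus_FR0_iff[of n M] M(1,2) sub assms(2)
    by (simp add: M_eq)
  ultimately show thesis using that M(2) M_eq by blast
qed

theorem theorem1p9:
  fixes n :: nat
  assumes "n > 1"
  shows "bij_betw (Phi n) (C0_orbits n) (FR0 n)"
proof (rule bij_betw_imageI)
  show "inj_on (Phi n) (C0_orbits n)"
  proof (rule inj_onI)
    fix X Y assume "X \<in> C0_orbits n" "Y \<in> C0_orbits n" "Phi n X = Phi n Y"
    then obtain v w where "X = orbit v" "Y = orbit w" "v \<in> C0 n" "w \<in> C0 n"
      "Phi n (orbit v) = Phi n (orbit w)" by (auto simp: C0_orbits_def)
    then show "X = Y"
      using eq_Phi_imp_in_orbit[OF assms] orbit_subset by (metis subset_antisym)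
  qed
  have Phi_C0: "Phi n (orbit v) = plus_minus (frieze_of a b)"
    if "v \<in> C0 n" "normalised_lift (bi_infinite n v) a b" for v a b
    using that assms C0_iff_normalised_lift Phi_orbit by simp
  show "Phi n ` C0_orbits n = FR0 n"
  proof (intro set_eqI iffI)
    fix S assume "S \<in> Phi n ` C0_orbits n"
    then obtain v where v: "v \<in> C0 n" "S = Phi n (orbit v)" by (auto simp: C0_orbits_def)
    obtain a b where lift: "normalised_lift (bi_infinite n v) a b"
      using C0_normalised_lift_exists assms v(1) by blast
    then show "S \<in> FR0 n"
      using v Phi_C0 C0_iff_normalised_lift[OF assms lift]
        plus_minus_FR0_iff[OF tame_frieze_normalised_lift normalised_lift_subdiagonal] by simp
  next
    fix S assume "S \<in> FR0 n"
    then obtain v a b where "v \<in> C0 n" "normalised_lift (bi_infinite n v) a b"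
      "S = plus_minus (frieze_of a b)"
      using FR0_normalised_lift[OF assms] by blast
    then have "v \<in> C0 n" "S = Phi n (orbit v)" by (simp_all add: Phi_C0)
    then show "S \<in> Phi n ` C0_orbits n" by (auto simp: C0_orbits_def)
  qed
qed

end
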